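(* Let $t\ge 1$, let $A_0$ be the incidence matrix of a doubly regular tournament of order $4t-1$, and let $A_1=A_0+I$, where $I$ is the identity matrix. Then, for $i\in\{0,1\}$, the array $B_i$ with entries in $\{0,1\}$ defined by $$B_i(x,y,z)=A_i(x,y)+A_i(y,z)+A_i(z,x)\ \bmod 2,\qquad x,y,z\in\{1,\dots,4t-1\},$$ is a $\mathcal{C}^3_3(4t-1,K_i,\Lambda_i)$-cube, where $$K_0=(2t-1)(4t+3),\qquad \Lambda_0=(2t-1)(2t+3),$$ $$K_1=2(4t^2-5t+2),\qquad \Lambda_1=4(t-1)^2.$$
   Context: An incidence matrix of a symmetric $(v,k,\lambda)$ design is a $v\times v$ matrix over $\{0,1\}$ with exactly $k$ ones in every row and column, such that the scalar product of any two distinct rows, and of any two distinct columns, is $\lambda$. A doubly regular tournament of order $4t-1$ is a symmetric $(4t-1,2t-1,t-1)$ design whose incidence matrix $A$ satisfies $A+A^\top=J-I$, where $J$ is the all-ones matrix. A $v\times v\times v$ array is a function on $\{1,\dots,v\}^3$. A layer is obtained by fixing one of the three coordinates; two layers are parallel if they fix the same coordinate, to different values; their scalar product is the sum over all positions of the product of corresponding entries. A $\mathcal{C}^3_3(v,K,\Lambda)$-cube is a $v\times v\times v$ array over $\{0,1\}$ such that every layer (in each of the three directions) contains exactly $K$ ones and every two parallel layers have scalar product $\Lambda$. *)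

theory Defs
  imports "Jordan_Normal_Form.Matrix"
begin

text \<open>
  Index sets of size \<open>v\<close> are \<open>{0..<v}\<close> instead of \<open>{1..v}\<close>, following the library's matrices.
  Entries are integers, so that subtraction never truncates.
\<close>

definition symmetric_design_matrix :: "nat \<Rightarrow> nat \<Rightarrow> nat \<Rightarrow> int mat \<Rightarrow> bool" where
  "symmetric_design_matrix v k l A \<longleftrightarrow>
     A \<in> carrier_mat v v \<and> elements_mat A \<subseteq> {0, 1} \<and>
     (\<forall>i<v. card {j. j < v \<and> A $$ (i, j) = 1} = k) \<and>
     (\<forall>j<v. card {i. i < v \<and> A $$ (i, j) = 1} = k) \<and>
     (\<forall>i<v. \<forall>j<v. i \<noteq> j \<longrightarrow> row A i \<bullet> row A j = int l) \<and>
     (\<forall>i<v. \<forall>j<v. i \<noteq> j \<longrightarrow> col A i \<bullet> col A j = int l)"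

definition all_ones_mat :: "nat \<Rightarrow> int mat" where
  "all_ones_mat v = mat v v (\<lambda>_. 1)"

text \<open>The natural-number subtractions below are exact for \<open>t \<ge> 1\<close>.\<close>

definition doubly_regular_tournament_matrix :: "nat \<Rightarrow> int mat \<Rightarrow> bool" where
  "doubly_regular_tournament_matrix t A \<longleftrightarrow>
     symmetric_design_matrix (4 * t - 1) (2 * t - 1) (t - 1) A \<and>
     A + A\<^sup>T = all_ones_mat (4 * t - 1) - 1\<^sub>m (4 * t - 1)"

text \<open>A \<open>v \<times> v \<times> v\<close> array is a function of which only the values on \<open>{0..<v}\<^sup>3\<close> matter.\<close>

type_synonym array3 = "nat \<Rightarrow> nat \<Rightarrow> nat \<Rightarrow> int"

datatype direction = X | Y | Z

text \<open>\<open>layer v B d a\<close> fixes the coordinate in direction \<open>d\<close> to the value \<open>a\<close>.\<close>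

primrec layer :: "nat \<Rightarrow> array3 \<Rightarrow> direction \<Rightarrow> nat \<Rightarrow> int mat" where
  "layer v B X a = mat v v (\<lambda>(y, z). B a y z)"
| "layer v B Y a = mat v v (\<lambda>(x, z). B x a z)"
| "layer v B Z a = mat v v (\<lambda>(x, y). B x y a)"

definition layer_scalar_prod :: "nat \<Rightarrow> int mat \<Rightarrow> int mat \<Rightarrow> int" where
  "layer_scalar_prod v L M = (\<Sum>i<v. \<Sum>j<v. L $$ (i, j) * M $$ (i, j))"

definition is_cube33 :: "nat \<Rightarrow> int \<Rightarrow> int \<Rightarrow> array3 \<Rightarrow> bool" where
  "is_cube33 v K \<Lambda> B \<longleftrightarrow>
     (\<forall>x<v. \<forall>y<v. \<forall>z<v. B x y z \<in> {0, 1}) \<and>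
     (\<forall>d. \<forall>a<v. int (card {(i, j). i < v \<and> j < v \<and> layer v B d a $$ (i, j) = 1}) = K) \<and>
     (\<forall>d. \<forall>a<v. \<forall>b<v. a \<noteq> b \<longrightarrow> layer_scalar_prod v (layer v B d a) (layer v B d b) = \<Lambda>)"

definition cyclic_sum_array :: "int mat \<Rightarrow> array3" where
  "cyclic_sum_array A x y z = (A $$ (x, y) + A $$ (y, z) + A $$ (z, x)) mod 2"

end

(*
  Write s = 1 - 2 A, a matrix of signs. Then 1 - 2 B(x,y,z) = s(x,y) s(y,z) s(z,x), so the numbers
  K and Lambda are read off the sums of this product over a layer and of the product of two layers.
  The tournament condition says that s + s^T = 2 e I (e = 1 for A_0, e = -1 for A_1) and
  s s^T = 4t I - J. Hence the layer sum, a diagonal entry of s^3, is e (7 - 12 t), and two parallel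
  layers factor, because s(y,z)^2 = 1, into the product of a row and a column orthogonality
  relation, (-1)(-1) = 1. The matrix of signs of A_1 is minus the transpose of that of A_0.
*)
theory Submission
  imports Defs
begin

lemma sum_of_01_eq_card:
  fixes f :: "'a \<Rightarrow> int"
  assumes "finite S" and "\<And>i. i \<in> S \<Longrightarrow> f i \<in> {0, 1}"
  shows "(\<Sum>i\<in>S. f i) = int (card {i \<in> S. f i = 1})"
proof -
  have "(\<Sum>i\<in>S. f i) = (\<Sum>i\<in>S. if f i = 1 then 1 else 0)"
    using assms(2) by (intro sum.cong) auto
  also have "\<dots> = int (card {i \<in> S. f i = 1})"
    using assms(1) by (simp add: sum.If_cases Int_def)
  finally show ?thesis .
qed

lemma sum_01_array_eq_card:
  fixes g :: "nat \<Rightarrow> nat \<Rightarrow> int"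
  assumes "\<And>i j. i < v \<Longrightarrow> j < v \<Longrightarrow> g i j \<in> {0, 1}"
  shows "int (card {(i, j). i < v \<and> j < v \<and> g i j = 1}) = (\<Sum>i<v. \<Sum>j<v. g i j)"
proof -
  have eq: "{(i, j). i < v \<and> j < v \<and> g i j = 1}
      = {p \<in> {..<v} \<times> {..<v}. (case p of (i, j) \<Rightarrow> g i j) = 1}"
    by auto
  show ?thesis
    unfolding eq sum.cartesian_product using assms
    by (intro sum_of_01_eq_card[symmetric]) auto
qed

text \<open>By cyclic invariance the \<open>Z\<close> layer at \<open>a\<close> equals the
  \<open>X\<close> layer at \<open>a\<close>, and the \<open>Y\<close> layer at \<open>a\<close> is
  its transpose. Counts and scalar products survive transposition, so a single direction
  suffices.\<close>

lemma is_cube33_of_cyclic: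
  assumes cyc: "\<And>x y z. B x y z = B y z x"
    and bin: "\<And>x y z. x < v \<Longrightarrow> y < v \<Longrightarrow> z < v \<Longrightarrow> B x y z \<in> {0, 1}"
    and ones: "\<And>a. a < v \<Longrightarrow> (\<Sum>i<v. \<Sum>j<v. B a i j) = K"
    and inner: "\<And>a b. a < v \<Longrightarrow> b < v \<Longrightarrow> a \<noteq> b \<Longrightarrow> (\<Sum>i<v. \<Sum>j<v. B a i j * B b i j) = \<Lambda>"
  shows "is_cube33 v K \<Lambda> B"
proof -
  have layer_Y: "layer v B Y a $$ (i, j) = B a j i"
    and layer_Z: "layer v B Z a $$ (i, j) = B a i j"
    if "i < v" "j < v" for a i j
    using that cyc[of i a j] cyc[of i j a] cyc[of j a i] by simp_all
  have layer_01: "layer v B d a $$ (i, j) \<in> {0, 1}" if "a < v" "i < v" "j < v" for d a i j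
    using that bin by (cases d) (simp_all add: layer_Y layer_Z del: layer.simps(2,3))
  have swap: "(\<Sum>i<v. \<Sum>j<v. f j i) = (\<Sum>i<v. \<Sum>j<v. f i j)" for f :: "nat \<Rightarrow> nat \<Rightarrow> int"
    by (rule sum.swap)
  have "int (card {(i, j). i < v \<and> j < v \<and> layer v B d a $$ (i, j) = 1}) = K"
    if "a < v" for d a
  proof -
    have "(\<Sum>i<v. \<Sum>j<v. layer v B d a $$ (i, j)) = (\<Sum>i<v. \<Sum>j<v. B a i j)"
      using swap[of "B a"] by (cases d) (simp_all add: layer_Y layer_Z del: layer.simps(2,3))
    then show ?thesis
      using sum_01_array_eq_card[of v "\<lambda>i j. layer v B d a $$ (i, j)"] layer_01 ones that
      by simp
  qed
  moreover have "layer_scalar_prod v (layer v B d a) (layer v B d b) = \<Lambda>"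
    if "a < v" "b < v" "a \<noteq> b" for d a b
  proof -
    have "layer_scalar_prod v (layer v B d a) (layer v B d b) = (\<Sum>i<v. \<Sum>j<v. B a i j * B b i j)"
      using swap[of "\<lambda>i j. B a i j * B b i j"]
      by (cases d) (simp_all add: layer_scalar_prod_def layer_Y layer_Z del: layer.simps(2,3))
    then show ?thesis
      using inner that by simp
  qed
  ultimately show ?thesis
    unfolding is_cube33_def using bin by blast
qed

text \<open>The parameter \<open>e\<close> is the common diagonal sign and also the row sum. Keeping
  it symbolic lets one computation serve both matrices. Only rows are constrained here; the column
  relations follow through \<open>skew\<close>.\<close>

locale skew_sign_matrix =
  fixes v :: nat and t e :: int and s :: "nat \<Rightarrow> nat \<Rightarrow> int"
  assumes order: "int v = 4 * t - 1"
    and sign: "x < v \<Longrightarrow> y < v \<Longrightarrow> s x y \<in> {1, -1}"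
    and skew: "x < v \<Longrightarrow> y < v \<Longrightarrow> s x y + s y x = (if x = y then 2 * e else 0)"
    and row_sum: "x < v \<Longrightarrow> (\<Sum>y<v. s x y) = e"
    and row_inner: "x < v \<Longrightarrow> y < v \<Longrightarrow> x \<noteq> y \<Longrightarrow> (\<Sum>z<v. s x z * s y z) = -1"
begin

lemma transpose_entry: "x < v \<Longrightarrow> y < v \<Longrightarrow> s y x = (if x = y then 2 * e else 0) - s x y"
  using skew[of x y] by simp

lemma diagonal: "x < v \<Longrightarrow> s x x = e"
  using skew[of x x] by simp

lemma sign_square: "x < v \<Longrightarrow> y < v \<Longrightarrow> s x y * s x y = 1"
  using sign[of x y] by auto

lemma diagonal_sign_square: "x < v \<Longrightarrow> e * e = 1"
  using sign_square[of x x] diagonal[of x] by simp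

lemma row_inner_if:
  "x < v \<Longrightarrow> y < v \<Longrightarrow> (\<Sum>z<v. s x z * s y z) = (if x = y then 4 * t else 0) - 1"
  by (cases "x = y") (simp_all add: row_inner sign_square order)

lemma col_sum:
  assumes "x < v"
  shows "(\<Sum>y<v. s y x) = e"
proof -
  have "(\<Sum>y<v. s y x) = (\<Sum>y<v. (if x = y then 2 * e else 0) - s x y)"
    using assms by (intro sum.cong) (simp_all add: transpose_entry[of x])
  then show ?thesis
    using assms by (simp add: sum_subtractf row_sum)
qed

text \<open>Rewriting both factors by \<open>transpose_entry\<close> gives the row product plus
  corrections at \<open>z = x\<close> and \<open>z = y\<close>. These add up to a multiple of
  \<open>s x y + s y x\<close>, which vanishes off the diagonal.\<close>

lemma col_inner:
  assumes "x < v" "y < v" "x \<noteq> y"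
  shows "(\<Sum>z<v. s z x * s z y) = -1"
proof -
  have "(\<Sum>z<v. s z x * s z y)
      = (\<Sum>z<v. s x z * s y z - (if x = z then 2 * e * s y z else 0)
          - (if y = z then 2 * e * s x z else 0))"
    using assms
    by (intro sum.cong refl) (auto simp: transpose_entry[of x] transpose_entry[of y] algebra_simps)
  also have "\<dots> = -1 - 2 * e * (s x y + s y x)"
    using assms by (simp add: sum_subtractf row_inner distrib_left)
  also have "\<dots> = -1"
    using assms by (simp add: skew)
  finally show ?thesis .
qed

text \<open>The rows of the new matrix are the negated columns of \<open>s\<close>: their sums
  change sign, while their scalar products stay the same.\<close>

lemma neg_transpose: "skew_sign_matrix v t (- e) (\<lambda>x y. - s y x)"
proof
  show "- s y x \<in> {1, -1}" if "x < v" "y < v" for x y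
    using sign[of y x] that by auto
  show "- s y x + - s x y = (if x = y then 2 * - e else 0)" if "x < v" "y < v" for x y
    using skew[of x y] that by (auto split: if_splits)
qed (simp_all add: order col_sum col_inner sum_negf)

text \<open>In matrix form, s^2 = s (2e I - s^T) = 2e s - s s^T = 2e s - 4t I + J.\<close>

lemma square_entry:
  assumes "x < v" "y < v"
  shows "(\<Sum>z<v. s x z * s z y) = 2 * e * s x y - (if x = y then 4 * t else 0) + 1"
proof -
  have "(\<Sum>z<v. s x z * s z y)
      = (\<Sum>z<v. (if y = z then 2 * e * s x z else 0) - s x z * s y z)"
    using assms by (intro sum.cong refl) (auto simp: transpose_entry[of y] algebra_simps)
  also have "\<dots> = 2 * e * s x y - (\<Sum>z<v. s x z * s y z)"
    using assms by (simp add: sum_subtractf)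
  finally show ?thesis
    using assms by (simp add: row_inner_if)
qed

text \<open>Multiplying the formula for s^2 by s gives s^3 = 2e s^2 - 4t s + s J. On the diagonal,
  s^2 has the entry 2 e^2 - 4t + 1, s has e, and s J has the row sum e; finally e^2 = 1.\<close>

lemma cube_diagonal:
  assumes "a < v"
  shows "(\<Sum>y<v. \<Sum>z<v. s a y * s y z * s z a) = e * (7 - 12 * t)"
proof -
  have "(\<Sum>y<v. \<Sum>z<v. s a y * s y z * s z a) = (\<Sum>y<v. s a y * (\<Sum>z<v. s y z * s z a))"
    by (simp add: sum_distrib_left mult.assoc)
  also have "\<dots> = (\<Sum>y<v. 2 * e * (s a y * s y a) - (if y = a then 4 * t * s a y else 0) + s a y)"
    using assms by (intro sum.cong refl) (auto simp: square_entry algebra_simps)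
  also have "\<dots> = 2 * e * (\<Sum>y<v. s a y * s y a) - 4 * t * s a a + (\<Sum>y<v. s a y)"
    using assms by (simp add: sum.distrib sum_subtractf sum_distrib_left)
  also have "\<dots> = 2 * e * (2 * (e * e) - 4 * t + 1) - 4 * t * e + e"
    using assms by (simp add: square_entry row_sum diagonal)
  finally show ?thesis
    using assms by (simp add: diagonal_sign_square algebra_simps)
qed

lemma parallel_layers:
  assumes "a < v" "b < v" "a \<noteq> b"
  shows "(\<Sum>y<v. \<Sum>z<v. (s a y * s y z * s z a) * (s b y * s y z * s z b)) = 1"
proof -
  have "(s a y * s y z * s z a) * (s b y * s y z * s z b) = (s a y * s b y) * (s z a * s z b)"
    if "y < v" "z < v" for y z
  proof -
    have "(s a y * s y z * s z a) * (s b y * s y z * s z b)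
        = (s a y * s b y) * (s z a * s z b) * (s y z * s y z)"
      by (simp only: ac_simps)
    then show ?thesis
      using that by (simp add: sign_square)
  qed
  then have "(\<Sum>y<v. \<Sum>z<v. (s a y * s y z * s z a) * (s b y * s y z * s z b))
      = (\<Sum>y<v. \<Sum>z<v. (s a y * s b y) * (s z a * s z b))"
    by (intro sum.cong refl) auto
  also have "\<dots> = (\<Sum>y<v. s a y * s b y) * (\<Sum>z<v. s z a * s z b)"
    by (simp add: sum_product)
  finally show ?thesis
    using assms by (simp add: row_inner col_inner)
qed

text \<open>The array is (1 - P) / 2 for the sign product P. The factors 2 and 4 in the hypotheses
  clear these denominators, so everything stays in the integers.\<close>

lemma cyclic_sum_array_is_cube33:
  assumes entry: "\<And>x y. x < v \<Longrightarrow> y < v \<Longrightarrow> s x y = 1 - 2 * A $$ (x, y)"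
    and K: "2 * K = (int v)\<^sup>2 - e * (7 - 12 * t)"
    and \<Lambda>: "4 * \<Lambda> = (int v)\<^sup>2 - 2 * (e * (7 - 12 * t)) + 1"
  shows "is_cube33 v K \<Lambda> (cyclic_sum_array A)"
proof (rule is_cube33_of_cyclic)
  let ?B = "cyclic_sum_array A"
  let ?P = "\<lambda>x y z. s x y * s y z * s z x"
  show "?B x y z = ?B y z x" for x y z
    by (simp add: cyclic_sum_array_def ac_simps)
  show "?B x y z \<in> {0, 1}" for x y z
    by (auto simp: cyclic_sum_array_def)
  have A_01: "A $$ (x, y) = 0 \<or> A $$ (x, y) = 1" if "x < v" "y < v" for x y
    using sign[of x y] entry[of x y] that by auto
  \<comment> \<open>Addition mod 2 of bits is multiplication of the signs 1 - 2 a; the eight cases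
    are checked directly.\<close>
  have sign_array: "2 * ?B x y z = 1 - ?P x y z" if "x < v" "y < v" "z < v" for x y z
    using A_01[of x y] A_01[of y z] A_01[of z x] that
    by (auto simp: cyclic_sum_array_def entry)
  show "(\<Sum>i<v. \<Sum>j<v. ?B a i j) = K" if "a < v" for a
  proof -
    have "2 * (\<Sum>i<v. \<Sum>j<v. ?B a i j) = (\<Sum>i<v. \<Sum>j<v. 1 - ?P a i j)"
      using that by (simp add: sum_distrib_left sign_array)
    also have "\<dots> = (int v)\<^sup>2 - e * (7 - 12 * t)"
      using that by (simp add: sum_subtractf cube_diagonal power2_eq_square)
    finally show ?thesis
      using K by simp
  qed
  show "(\<Sum>i<v. \<Sum>j<v. ?B a i j * ?B b i j) = \<Lambda>" if "a < v" "b < v" "a \<noteq> b" for a b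
  proof -
    have "4 * (?B a i j * ?B b i j) = 1 - ?P a i j - ?P b i j + ?P a i j * ?P b i j"
      if "i < v" "j < v" for i j
    proof -
      have "4 * (?B a i j * ?B b i j) = (2 * ?B a i j) * (2 * ?B b i j)"
        by simp
      also have "\<dots> = (1 - ?P a i j) * (1 - ?P b i j)"
        using that \<open>a < v\<close> \<open>b < v\<close> by (simp only: sign_array)
      finally show ?thesis
        by (simp add: algebra_simps)
    qed
    then have "4 * (\<Sum>i<v. \<Sum>j<v. ?B a i j * ?B b i j)
        = (\<Sum>i<v. \<Sum>j<v. 1 - ?P a i j - ?P b i j + ?P a i j * ?P b i j)"
      by (simp add: sum_distrib_left)
    \<comment> \<open>Each single layer contributes one \<open>cube_diagonal\<close>; the final 1 is
      the mixed term from \<open>parallel_layers\<close>.\<close>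
    also have "\<dots> = (int v)\<^sup>2 - 2 * (e * (7 - 12 * t)) + 1"
      using that
      by (simp add: sum_subtractf sum.distrib cube_diagonal parallel_layers power2_eq_square)
    finally show ?thesis
      using \<Lambda> by simp
  qed
qed

end

lemma skew_sign_matrix_of_tournament:
  assumes t: "t \<ge> 1" and A: "doubly_regular_tournament_matrix t A"
  shows "skew_sign_matrix (4 * t - 1) (int t) 1 (\<lambda>x y. 1 - 2 * A $$ (x, y))"
proof
  let ?v = "4 * t - 1"
  have design: "symmetric_design_matrix ?v (2 * t - 1) (t - 1) A"
    and sum_transpose: "A + A\<^sup>T = all_ones_mat ?v - 1\<^sub>m ?v"
    using A by (auto simp: doubly_regular_tournament_matrix_def)
  have carrier: "A \<in> carrier_mat ?v ?v"
    using design by (simp add: symmetric_design_matrix_def)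
  \<comment> \<open>Here \<open>t \<ge> 1\<close> makes the truncated subtraction exact.\<close>
  show order: "int ?v = 4 * int t - 1"
    using t by simp
  have A_01: "A $$ (x, y) \<in> {0, 1}" if "x < ?v" "y < ?v" for x y
    using design carrier that elements_matI[of A ?v ?v x y]
    unfolding symmetric_design_matrix_def by blast
  then show "1 - 2 * A $$ (x, y) \<in> {1, -1}" if "x < ?v" "y < ?v" for x y
    using that by fastforce
  show "1 - 2 * A $$ (x, y) + (1 - 2 * A $$ (y, x)) = (if x = y then 2 * 1 else 0)"
    if "x < ?v" "y < ?v" for x y
  proof -
    have "(A + A\<^sup>T) $$ (x, y) = (all_ones_mat ?v - 1\<^sub>m ?v) $$ (x, y)"
      by (simp only: sum_transpose)
    then have "A $$ (x, y) + A $$ (y, x) = 1 - (if x = y then 1 else 0)"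
      using that carrier by (simp add: all_ones_mat_def)
    then show ?thesis
      by (auto split: if_splits)
  qed
  have row_ones: "(\<Sum>y<?v. A $$ (x, y)) = 2 * int t - 1" if "x < ?v" for x
  proof -
    have "(\<Sum>y<?v. A $$ (x, y)) = int (card {y \<in> {..<?v}. A $$ (x, y) = 1})"
      using A_01 that by (intro sum_of_01_eq_card) auto
    also have "\<dots> = int (2 * t - 1)"
      using design that by (simp add: symmetric_design_matrix_def)
    finally show ?thesis
      using t by simp
  qed
  \<comment> \<open>The value is (4t - 1) - 2 (2t - 1), in agreement with the diagonal sign e = 1 of
    a matrix with zero diagonal.\<close>
  show "(\<Sum>y<?v. 1 - 2 * A $$ (x, y)) = 1" if "x < ?v" for x
    using row_ones[OF that] order by (simp add: sum_subtractf flip: sum_distrib_left)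
  show "(\<Sum>z<?v. (1 - 2 * A $$ (x, z)) * (1 - 2 * A $$ (y, z))) = -1"
    if "x < ?v" "y < ?v" "x \<noteq> y" for x y
  proof -
    have "row A x \<bullet> row A y = int (t - 1)"
      using design that by (simp add: symmetric_design_matrix_def)
    moreover have "row A x \<bullet> row A y = (\<Sum>z<?v. A $$ (x, z) * A $$ (y, z))"
      using carrier that by (simp add: scalar_prod_def lessThan_atLeast0)
    ultimately have inner: "(\<Sum>z<?v. A $$ (x, z) * A $$ (y, z)) = int t - 1"
      using t by simp
    have "(\<Sum>z<?v. (1 - 2 * A $$ (x, z)) * (1 - 2 * A $$ (y, z)))
        = (\<Sum>z<?v. 1 - 2 * A $$ (x, z) - 2 * A $$ (y, z) + 4 * (A $$ (x, z) * A $$ (y, z)))"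
      by (simp add: algebra_simps)
    \<comment> \<open>Two row sums and one design scalar product enter; the total is (4t - 1) - 4
      (2t - 1) + 4 (t - 1) = -1.\<close>
    also have "\<dots> = int ?v - 2 * (2 * int t - 1) - 2 * (2 * int t - 1) + 4 * (int t - 1)"
      using that inner row_ones
      by (simp add: sum_subtractf sum.distrib flip: sum_distrib_left)
    finally show ?thesis
      using order by simp
  qed
qed

theorem theorem4p8:
  fixes t :: nat and A\<^sub>0 A\<^sub>1 :: "int mat"
  assumes "t \<ge> 1"
    and "doubly_regular_tournament_matrix t A\<^sub>0"
    and "A\<^sub>1 = A\<^sub>0 + 1\<^sub>m (4 * t - 1)"
  shows "is_cube33 (4 * t - 1)
           ((2 * int t - 1) * (4 * int t + 3))
           ((2 * int t - 1) * (2 * int t + 3))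
           (cyclic_sum_array A\<^sub>0)
       \<and> is_cube33 (4 * t - 1)
           (2 * (4 * (int t)\<^sup>2 - 5 * int t + 2))
           (4 * (int t - 1)\<^sup>2)
           (cyclic_sum_array A\<^sub>1)"
proof
  let ?v = "4 * t - 1"
  let ?s = "\<lambda>x y. 1 - 2 * A\<^sub>0 $$ (x, y)"
  interpret S: skew_sign_matrix ?v "int t" 1 ?s
    using assms by (intro skew_sign_matrix_of_tournament)
  interpret T: skew_sign_matrix ?v "int t" "-1" "\<lambda>x y. - ?s y x"
    by (rule S.neg_transpose)
  have carrier: "A\<^sub>0 \<in> carrier_mat ?v ?v"
    using assms(2)
    by (simp add: doubly_regular_tournament_matrix_def symmetric_design_matrix_def)
  show "is_cube33 ?v ((2 * int t - 1) * (4 * int t + 3)) ((2 * int t - 1) * (2 * int t + 3))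
      (cyclic_sum_array A\<^sub>0)"
    \<comment> \<open>With v = 4t - 1 and e = 1, the right-hand sides for 2K and 4 Lambda are 16 t^2
      + 4t - 6 and 16 t^2 + 16t - 12.\<close>
    by (rule S.cyclic_sum_array_is_cube33)
      (simp_all only: S.order, simp_all add: power2_eq_square algebra_simps)
  show "is_cube33 ?v (2 * (4 * (int t)\<^sup>2 - 5 * int t + 2)) (4 * (int t - 1)\<^sup>2)
      (cyclic_sum_array A\<^sub>1)"
  proof (rule T.cyclic_sum_array_is_cube33)
    \<comment> \<open>This is the tournament equation again: adding I to \<open>A\<^sub>0\<close>
      subtracts 2I from the signs, and s - 2I = - s^T.\<close>
    show "- ?s y x = 1 - 2 * A\<^sub>1 $$ (x, y)" if "x < ?v" "y < ?v" for x y
      using S.skew[OF that] that carrier assms(3) by (auto split: if_splits)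
  qed (simp_all only: S.order, simp_all add: power2_eq_square algebra_simps)
qed

end
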